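(* Let $G$ be a cactus. Then $\gamma_c(G)=\gamma_{\rm wcon}(G)$ if and only if both of the following hold: (1) for every cycle $C=C_i$ of $G$ with $i\in\{5,6\}$, either $d(v)\geq 3$ for every $v\in V(C_i)$, or $C_i$ has two adjacent vertices of degree 2; (2) for every cycle $C=C_i$ of $G$ with $i\geq 7$, $d(v)\geq 3$ for every $v\in V(C)$.
   Context: Graphs are finite, simple, undirected, connected. A cactus is a connected graph in which any two simple cycles share at most one vertex. $d(v)$ denotes the degree of $v$ in $G$. A set $D$ is dominating if every vertex outside $D$ has a neighbour in $D$; connected dominating if also $G[D]$ is connected; weakly convex if for any $a,b\in D$ some shortest $(a-b)$-path in $G$ lies in $D$. $\gamma_c(G)$, $\gamma_{\rm wcon}(G)$ denote the minimum sizes of a connected dominating set and a weakly convex dominating set. *)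

theory Defs
  imports "Graph_Theory.Graph_Theory"
begin

text \<open>
  A finite simple undirected graph is a digraph satisfying the locale \<^locale>\<open>graph\<close>: finite,
  loop-free, without parallel arcs, and symmetric, so that an undirected edge is a pair of opposite
  arcs. In such a digraph the degree of a vertex is its \<^const>\<open>out_degree\<close>.
\<close>

text \<open>
  The library's \<^const>\<open>pre_digraph.cycle\<close> also accepts walking along an edge and back again; the
  length bound excludes exactly these closed walks.
\<close>

definition simple_cycle :: "('a, 'b) pre_digraph \<Rightarrow> 'b list \<Rightarrow> bool" where
  "simple_cycle G c \<longleftrightarrow> pre_digraph.cycle G c \<and> 3 \<le> length c"

definition cycle_verts :: "('a, 'b) pre_digraph \<Rightarrow> 'b list \<Rightarrow> 'a set" where
  "cycle_verts G c = tail G ` set c"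

definition cycle_edges :: "('a, 'b) pre_digraph \<Rightarrow> 'b list \<Rightarrow> 'a set set" where
  "cycle_edges G c = (\<lambda>e. {tail G e, head G e}) ` set c"

text \<open>
  An arc list records a starting point and an orientation, so one cycle is represented by several
  lists. Two lists represent the same cycle iff they have the same undirected edges; the same
  vertices would not suffice (compare the 4-cycles of a complete graph on four vertices).
  \<^const>\<open>Digraph_Component.connected\<close> includes that there is at least one vertex.
\<close>

definition cactus :: "('a, 'b) pre_digraph \<Rightarrow> bool" where
  "cactus G \<longleftrightarrow> graph G \<and> Digraph_Component.connected G \<and>
    (\<forall>c c'. simple_cycle G c \<and> simple_cycle G c' \<and> cycle_edges G c \<noteq> cycle_edges G c' \<longrightarrow>
       card (cycle_verts G c \<inter> cycle_verts G c') \<le> 1)"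

definition dominating_set :: "('a, 'b) pre_digraph \<Rightarrow> 'a set \<Rightarrow> bool" where
  "dominating_set G D \<longleftrightarrow> D \<subseteq> verts G \<and> (\<forall>v \<in> verts G - D. \<exists>u \<in> D. v \<rightarrow>\<^bsub>G\<^esub> u)"

definition connected_dominating_set :: "('a, 'b) pre_digraph \<Rightarrow> 'a set \<Rightarrow> bool" where
  "connected_dominating_set G D \<longleftrightarrow> dominating_set G D \<and> Digraph_Component.connected (G \<restriction> D)"

definition shortest_path :: "('a, 'b) pre_digraph \<Rightarrow> 'a \<Rightarrow> 'b list \<Rightarrow> 'a \<Rightarrow> bool" where
  "shortest_path G a p b \<longleftrightarrow> pre_digraph.apath G a p b \<and>
    (\<forall>q. pre_digraph.apath G a q b \<longrightarrow> length p \<le> length q)"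

definition weakly_convex :: "('a, 'b) pre_digraph \<Rightarrow> 'a set \<Rightarrow> bool" where
  "weakly_convex G D \<longleftrightarrow> D \<subseteq> verts G \<and>
    (\<forall>a \<in> D. \<forall>b \<in> D. \<exists>p. shortest_path G a p b \<and> set (pre_digraph.awalk_verts G a p) \<subseteq> D)"

definition connected_domination_number :: "('a, 'b) pre_digraph \<Rightarrow> nat" (\<open>\<gamma>\<^sub>c\<close>) where
  "\<gamma>\<^sub>c G = Min {card D | D. connected_dominating_set G D}"

definition weakly_convex_domination_number :: "('a, 'b) pre_digraph \<Rightarrow> nat"
    (\<open>\<gamma>\<^sub>w\<^sub>c\<^sub>o\<^sub>n\<close>) where
  "\<gamma>\<^sub>w\<^sub>c\<^sub>o\<^sub>n G = Min {card D | D. dominating_set G D \<and> weakly_convex G D}"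

end

theory Submission
  imports Defs
begin

text \<open>
  If a connected dominating set misses a vertex \<open>x\<close> of a cycle \<open>C\<close>, then the graph without \<open>x\<close> is
  still connected, so a third neighbour of \<open>x\<close> would give a second cycle sharing an edge with \<open>C\<close>.
  Hence missing cycle vertices have degree 2 and, being dominated, occur in runs of at most two.

  A minimum weakly convex dominating set \<open>D\<close> that is also a minimum connected one cannot contain a
  whole cycle with a vertex of degree 2, as that vertex could be dropped. So \<open>D\<close> misses a run of
  \<open>k \<le> 2\<close> vertices of the cycle, and a geodesic in \<open>D\<close> between the neighbours of the run closes it
  to a cycle of length at most \<open>2 * k + 2\<close>, which must be the given one.

  Conversely, a walk that leaves a minimum connected dominating set \<open>D\<close> along a run of \<open>k \<le> 2\<close>
  missing vertices can be rerouted inside \<open>D\<close> along the rest of the cycle closed by that run. This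
  is no longer unless \<open>k = 1\<close> and the cycle has length 5 or 6; but then adding the missing vertex
  and deleting two adjacent vertices of degree 2 would make \<open>D\<close> smaller.
\<close>

section \<open>Cycles as vertex lists\<close>

text \<open>Vertex lists can be rotated, reversed and cut into runs by plain list operations.
  Prefixing \<open>last xs\<close> adds the closing edge, while \<open>distinct\<close> still
  applies to \<open>xs\<close> itself.\<close>

definition vcycle :: "('a, 'b) pre_digraph \<Rightarrow> 'a list \<Rightarrow> bool" where
  "vcycle G xs \<longleftrightarrow> 3 \<le> length xs \<and> distinct xs \<and> vwalk (last xs # xs) G"

definition vcycle_edges :: "'a list \<Rightarrow> 'a set set" where
  "vcycle_edges xs = (\<lambda>(u, v). {u, v}) ` set (vwalk_arcs (last xs # xs))"

text \<open>Weak convexity compares lengths, so cutting the detours out of a walk must be known not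
  to lengthen it.\<close>

lemma length_vwalk_to_vpath: "length (vwalk_to_vpath p) \<le> length p"
proof (induct p rule: vwalk_to_vpath_induct3)
  case (in_set x xs)
  then show ?case
    using length_dropWhile_le[of "\<lambda>y. y \<noteq> x" xs] by simp
qed simp_all

lemma vwalk_imp_short_vpath:
  assumes "vwalk p G"
  obtains q where "vpath q G" "hd q = hd p" "last q = last p" "set q \<subseteq> set p" "length q \<le> length p"
  using assms vwalk_to_vpath_vpath vwalk_to_vpath_hd vwalk_to_vpath_last vwalk_to_vpath_subset
    length_vwalk_to_vpath by (metis subsetI)

lemma vwalk_append_iff:
  assumes "p \<noteq> []" "q \<noteq> []"
  shows "vwalk (p @ q) G \<longleftrightarrow> vwalk p G \<and> vwalk q G \<and> last p \<rightarrow>\<^bsub>G\<^esub> hd q"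
  using assms by (auto simp: vwalk_def vwalk_arcs_append)

lemma set_vwalk_join_subset: "set (p \<oplus> q) \<subseteq> set p \<union> set q"
  by (cases q) (auto simp: vwalk_join_def)

lemma vcycle_rotate:
  assumes "vcycle G (xs @ ys)"
  shows "vcycle G (ys @ xs)"
proof (cases "xs = [] \<or> ys = []")
  case False
  then show ?thesis
    using assms by (auto simp: vcycle_def vwalk_def vwalk_arcs_append)
qed (use assms in auto)

lemma vcycle_starting_at:
  assumes "vcycle G xs" "x \<in> set xs"
  obtains ys where "vcycle G (x # ys)" "set (x # ys) = set xs" "length (x # ys) = length xs"
proof -
  obtain us vs where xs: "xs = us @ x # vs"
    using assms(2) by (meson split_list)
  have "vcycle G (x # vs @ us)"
    using vcycle_rotate[of G us "x # vs"] assms(1) xs by simp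
  then show thesis
    using that[of "vs @ us"] xs by auto
qed

text \<open>The cactus condition identifies cycles by their edges; this recovers the vertices, and
  with them the length.\<close>

lemma Union_vcycle_edges:
  assumes "xs \<noteq> []"
  shows "\<Union> (vcycle_edges xs) = set xs"
proof -
  have "\<Union> ((\<lambda>(u, v). {u, v}) ` set (vwalk_arcs (y # ys))) = insert y (set ys)"
    if "ys \<noteq> []" for y :: 'a and ys
    using that
  proof (induct ys arbitrary: y)
    case (Cons z zs)
    then show ?case by (cases "zs = []") auto
  qed simp
  then show ?thesis
    using assms unfolding vcycle_edges_def by (metis insert_absorb last_in_set)
qed

text \<open>As \<open>x\<close> occurs only once in the list, just two edges of the closed walk
  contain it, one to each end of \<open>ys\<close>.\<close>

lemma vcycle_edges_Cons:
  assumes "ys \<noteq> []" "x \<notin> set ys" "{x, w} \<in> vcycle_edges (x # ys)"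
  shows "w = hd ys \<or> w = last ys"
  using assms arcs_in_vwalk_arcs[of _ ys]
  by (fastforce simp: vcycle_edges_def doubleton_eq_iff)

section \<open>Translation between arc cycles and vertex cycles\<close>

lemma (in wf_digraph) vwalk_imp_awalk:
  assumes "vwalk p G"
  obtains q where "awalk (hd p) q (last p)" "awalk_verts (hd p) q = p"
proof -
  have "\<exists>q. awalk (hd p) q (last p) \<and> awalk_verts (hd p) q = p"
    using assms
  proof (induct p)
    case (Base u)
    then show ?case by (intro exI[of _ "[]"]) (auto simp: awalk_simps)
  next
    case (Cons u v es)
    then obtain q where "awalk v q (last (v # es))" "awalk_verts v q = v # es"
      by auto
    moreover obtain e where "e \<in> arcs G" "tail G e = u" "head G e = v"
      using Cons(1) by (auto simp: arcs_ends_conv)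
    ultimately show ?case
      by (intro exI[of _ "e # q"]) (auto simp: awalk_simps)
  qed
  then show thesis using that by blast
qed

lemma (in wf_digraph) arcs_awalk_verts:
  "awalk u q v \<Longrightarrow> vwalk_arcs (awalk_verts u q) = map (\<lambda>e. (tail G e, head G e)) q"
  by (induct q arbitrary: u) (auto simp: awalk_simps)

lemma (in wf_digraph) simple_cycle_awalk:
  assumes "awalk (last xs) c (last xs)" "awalk_verts (last xs) c = last xs # xs" "xs \<noteq> []"
  shows "length c = length xs" "cycle_verts G c = set xs" "cycle_edges G c = vcycle_edges xs"
proof -
  show "length c = length xs"
    using length_awalk_verts[of "last xs" c] assms by simp
  then have c: "c \<noteq> []"
    using assms by auto
  \<comment> \<open>The tails omit only the final vertex of the closed walk, which is also its first
    one.\<close>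
  then have "map (tail G) c = butlast (last xs # xs)"
    using assms(2) awalk_verts_conv[of "last xs" c] by (metis butlast_snoc)
  then have "set (map (tail G) c) = set xs"
    using assms(3) by (metis append_butlast_last_id butlast.simps(2) list.set(2) set_append
        Un_insert_right Un_empty_right list.set(1))
  then show "cycle_verts G c = set xs"
    by (simp add: cycle_verts_def)
  show "cycle_edges G c = vcycle_edges xs"
    using arcs_awalk_verts[OF assms(1)] assms(2)
    by (simp add: cycle_edges_def vcycle_edges_def image_image)
qed

lemma (in wf_digraph) simple_cycle_imp_vcycle:
  assumes c: "simple_cycle G c"
  obtains xs where "vcycle G xs" "length xs = length c" "set xs = cycle_verts G c"
    "vcycle_edges xs = cycle_edges G c"
proof -
  obtain u where u: "awalk u c u" "distinct (tl (awalk_verts u c))" "3 \<le> length c"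
    using c by (auto simp: simple_cycle_def cycle_def)
  \<comment> \<open>Dropping the repeated start leaves each vertex once, with \<open>u\<close> at
    the end, as \<open>vcycle\<close> expects.\<close>
  define xs where "xs = tl (awalk_verts u c)"
  have v: "awalk_verts u c = u # xs"
    using u(1) unfolding xs_def by (metis awalk_verts_non_Nil awhd_of_awalk list.collapse)
  have len: "length xs = length c"
    using length_awalk_verts[of u c] v by simp
  then have "xs \<noteq> []" using u by auto
  moreover from this have "last xs = u"
    using u(1) v by (metis awlast_if_cas awalkE last_ConsR)
  ultimately have *: "awalk (last xs) c (last xs)" "awalk_verts (last xs) c = last xs # xs" "xs \<noteq> []"
    using u v by auto
  moreover have "vcycle G xs"
    using awalk_imp_vwalk[OF *(1)] u len v *(2) by (auto simp: vcycle_def)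
  ultimately show thesis
    using that simple_cycle_awalk by metis
qed

lemma (in wf_digraph) vcycle_imp_simple_cycle:
  assumes xs: "vcycle G xs"
  obtains c where "simple_cycle G c" "length c = length xs" "cycle_verts G c = set xs"
    "cycle_edges G c = vcycle_edges xs"
proof -
  have "xs \<noteq> []" "vwalk (last xs # xs) G" using xs by (auto simp: vcycle_def)
  then obtain c where c: "awalk (last xs) c (last xs)" "awalk_verts (last xs) c = last xs # xs"
    using vwalk_imp_awalk[of "last xs # xs"] by auto
  note * = simple_cycle_awalk[OF c \<open>xs \<noteq> []\<close>]
  have "simple_cycle G c"
    using c * xs by (auto simp: simple_cycle_def cycle_def vcycle_def)
  with * show thesis
    using that by blast
qed

section \<open>Connectedness and weak convexity in terms of vertex paths\<close>

lemma (in wf_digraph) arcs_ends_induce_subgraph: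
  "arcs_ends (G \<restriction> D) = arcs_ends G \<inter> D \<times> D"
  by (auto simp: arcs_ends_conv)

lemma (in wf_digraph) vwalk_induce_subgraph:
  assumes "D \<subseteq> verts G"
  shows "vwalk p (G \<restriction> D) \<longleftrightarrow> vwalk p G \<and> set p \<subseteq> D"
  using assms arcs_in_vwalk_arcs[of _ p]
  by (fastforce simp: vwalk_def arcs_ends_induce_subgraph)

context graph
begin

lemma adj_sym: "u \<rightarrow> v \<Longrightarrow> v \<rightarrow> u"
  using sym_arcs by (rule arcs_ends_symmetric)

lemma adj_irrefl: "\<not> u \<rightarrow> u"
  using no_loops by (auto simp: arcs_ends_conv)

lemma out_degree_eq_card: "out_degree G v = card {w. v \<rightarrow> w}"
proof -
  have "inj_on (head G) (out_arcs G v)"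
    using no_multi_arcs by (auto simp: inj_on_def arc_to_ends_def)
  moreover have "head G ` out_arcs G v = {w. v \<rightarrow> w}"
    by (auto simp: arcs_ends_conv)
  ultimately show ?thesis
    unfolding out_degree_def by (metis card_image)
qed

lemma finite_neighbours: "finite {w. v \<rightarrow> w}"
  by (rule finite_subset[of _ "verts G"]) (auto dest: adj_in_verts)

text \<open>Connectedness is defined through the symmetric closure. An induced subgraph of a
  symmetric graph is itself symmetric, so its own vertex paths decide.\<close>

lemma connected_induce_subgraph_iff:
  assumes "D \<subseteq> verts G"
  shows "Digraph_Component.connected (G \<restriction> D) \<longleftrightarrow> D \<noteq> {} \<and>
    (\<forall>a\<in>D. \<forall>b\<in>D. \<exists>p. vpath p G \<and> set p \<subseteq> D \<and> hd p = a \<and> last p = b)"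
proof -
  interpret H: wf_digraph "G \<restriction> D" by (rule wellformed_induce_subgraph)
  have "symmetric (G \<restriction> D)"
    using adj_sym by (auto simp: symmetric_def sym_def arcs_ends_induce_subgraph)
  then show ?thesis
    unfolding connected_def strongly_connected_def
    by (simp add: H.reachable_mk_symmetric_eq H.reachable_vpath_conv vpath_def
        vwalk_induce_subgraph[OF assms] conj_ac)
qed

lemma connected_iff:
  "Digraph_Component.connected G \<longleftrightarrow> verts G \<noteq> {} \<and>
    (\<forall>a\<in>verts G. \<forall>b\<in>verts G. \<exists>p. vpath p G \<and> hd p = a \<and> last p = b)"
  using sym_arcs unfolding connected_def strongly_connected_def
  by (simp add: reachable_mk_symmetric_eq reachable_vpath_conv)

lemma vcycle_rev:
  assumes "vcycle G xs"
  shows "vcycle G (rev xs)"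
proof (cases xs)
  case (Cons x ys)
  then have "vwalk (x # ys @ [x]) G"
    using vcycle_rotate[of G "[x]" ys] assms by (simp add: vcycle_def)
  then have "vwalk (rev (x # ys @ [x])) G"
    using vwalk_rev_ex[OF sym_arcs] by blast
  then show ?thesis
    using assms Cons by (simp add: vcycle_def)
qed (use assms in \<open>auto simp: vcycle_def\<close>)

lemma vcycle_Cons_iff:
  "vcycle G (x # ys) \<longleftrightarrow>
    2 \<le> length ys \<and> distinct ys \<and> x \<notin> set ys \<and> vwalk ys G \<and> x \<rightarrow> hd ys \<and> last ys \<rightarrow> x"
  by (cases ys) (auto simp: vcycle_def)

text \<open>Every path between members of \<open>D\<close> is matched by one inside
  \<open>D\<close>, instead of exhibiting a geodesic; this form admits induction on the given path.
  Connectedness supplies a first path, so that a shortest one exists.\<close>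

lemma weakly_convex_iff:
  assumes "Digraph_Component.connected G"
  shows "weakly_convex G D \<longleftrightarrow> D \<subseteq> verts G \<and>
    (\<forall>p. vpath p G \<and> hd p \<in> D \<and> last p \<in> D \<longrightarrow>
      (\<exists>q. vpath q G \<and> set q \<subseteq> D \<and> hd q = hd p \<and> last q = last p \<and> length q \<le> length p))"
proof (cases "D \<subseteq> verts G")
  case True
  have to_vpath: "vpath (awalk_verts a p) G" "hd (awalk_verts a p) = a" "last (awalk_verts a p) = b"
    if "apath a p b" for a p b
    using that awalk_imp_vwalk by (auto simp: apath_def)
  have of_vpath: "\<exists>q. apath (hd p) q (last p) \<and> awalk_verts (hd p) q = p" if "vpath p G" for p
    using that vwalk_imp_awalk[of p] by (metis apath_def vpath_def)
  show ?thesis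
  proof
    assume D: "weakly_convex G D"
    show "D \<subseteq> verts G \<and> (\<forall>p. vpath p G \<and> hd p \<in> D \<and> last p \<in> D \<longrightarrow>
      (\<exists>q. vpath q G \<and> set q \<subseteq> D \<and> hd q = hd p \<and> last q = last p \<and> length q \<le> length p))"
    proof (safe)
      fix p assume p: "vpath p G" "hd p \<in> D" "last p \<in> D"
      then obtain r where r: "shortest_path G (hd p) r (last p)" "set (awalk_verts (hd p) r) \<subseteq> D"
        using D unfolding weakly_convex_def by blast
      obtain s where s: "apath (hd p) s (last p)" "awalk_verts (hd p) s = p"
        using of_vpath p by blast
      have "length (awalk_verts (hd p) r) \<le> length p"
        using r(1) s length_awalk_verts[of "hd p"] unfolding shortest_path_def by (metis Suc_le_mono)
      then show "\<exists>q. vpath q G \<and> set q \<subseteq> D \<and> hd q = hd p \<and> last q = last p \<and> length q \<le> length p"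
        using r to_vpath unfolding shortest_path_def by blast
    qed (use True in auto)
  next
    assume D: "D \<subseteq> verts G \<and> (\<forall>p. vpath p G \<and> hd p \<in> D \<and> last p \<in> D \<longrightarrow>
      (\<exists>q. vpath q G \<and> set q \<subseteq> D \<and> hd q = hd p \<and> last q = last p \<and> length q \<le> length p))"
    have "\<exists>p. shortest_path G a p b \<and> set (awalk_verts a p) \<subseteq> D" if ab: "a \<in> D" "b \<in> D" for a b
    proof -
      have "\<exists>p. apath a p b"
        using assms ab True of_vpath unfolding connected_iff by (metis subsetD)
      then obtain s where s: "apath a s b" "\<And>t. apath a t b \<Longrightarrow> length s \<le> length t"
        using ex_has_least_nat[of "\<lambda>p. apath a p b" _ length] by blast
      obtain q where q: "vpath q G" "set q \<subseteq> D" "hd q = a" "last q = b"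
          "length q \<le> length (awalk_verts a s)"
        using D to_vpath[OF s(1)] ab by metis
      obtain t where t: "apath a t b" "awalk_verts a t = q"
        using of_vpath[OF q(1)] q by auto
      \<comment> \<open>The path inside \<open>D\<close> is no longer than the geodesic
        \<open>s\<close>, hence a geodesic too.\<close>
      then have "length t \<le> length s"
        using q(5) length_awalk_verts[of a] by (metis Suc_le_mono)
      then show ?thesis
        using t q s(2) unfolding shortest_path_def by (metis le_trans)
    qed
    then show "weakly_convex G D"
      using True unfolding weakly_convex_def by blast
  qed
qed (simp add: weakly_convex_def)

text \<open>Any path between two members can be replaced by one inside \<open>D\<close>. Hence
  \<open>\<gamma>\<^sub>c G\<close> never exceeds
  \<open>\<gamma>\<^sub>w\<^sub>c\<^sub>o\<^sub>n G\<close>.\<close>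

lemma weakly_convex_dominating_imp_connected_dominating:
  assumes G: "Digraph_Component.connected G" and D: "dominating_set G D" "weakly_convex G D"
  shows "connected_dominating_set G D"
proof -
  have sub: "D \<subseteq> verts G" and "D \<noteq> {}"
    using D G by (auto simp: dominating_set_def connected_iff)
  moreover have "\<exists>p. vpath p G \<and> set p \<subseteq> D \<and> hd p = a \<and> last p = b" if ab: "a \<in> D" "b \<in> D" for a b
  proof -
    obtain p where "vpath p G" "hd p = a" "last p = b"
      using G ab sub unfolding connected_iff by (metis subsetD)
    then show ?thesis
      using D(2) ab unfolding weakly_convex_iff[OF G] by metis
  qed
  ultimately show ?thesis
    using D(1) by (simp add: connected_dominating_set_def connected_induce_subgraph_iff)
qed

section \<open>Deleting vertices from a connected dominating set\<close>

text \<open>A walk inside \<open>D\<close> that enters \<open>S\<close> does so from a vertex of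
  \<open>zs\<close>; there it can follow \<open>zs\<close> to its end instead. So all remaining
  vertices reach \<open>last zs\<close> without \<open>S\<close>. In the applications
  \<open>S\<close> consists of degree 2 vertices of a cycle and \<open>zs\<close> is the rest of
  that cycle.\<close>

lemma connected_dominating_set_Diff:
  assumes D: "connected_dominating_set G D"
    and zs: "vwalk zs G" "set zs \<subseteq> D" "S \<inter> set zs = {}"
    and S: "S \<subseteq> D" "\<And>s w. s \<in> S \<Longrightarrow> s \<rightarrow> w \<Longrightarrow> w \<in> S \<union> set zs"
      "\<And>s. s \<in> S \<Longrightarrow> \<exists>z\<in>set zs. s \<rightarrow> z"
  shows "connected_dominating_set G (D - S)"
proof -
  have sub: "D \<subseteq> verts G"
    using D by (simp add: connected_dominating_set_def dominating_set_def)
  have conn: "\<exists>p. vpath p G \<and> set p \<subseteq> D \<and> hd p = a \<and> last p = b" if "a \<in> D" "b \<in> D" for a b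
    using D that connected_induce_subgraph_iff[OF sub] by (simp add: connected_dominating_set_def)
  have "zs \<noteq> []" using zs by auto
  define R where "R a \<longleftrightarrow> (\<exists>p. vwalk p G \<and> set p \<subseteq> D - S \<and> hd p = a \<and> last p = last zs)" for a
  have R_zs: "R z" if z: "z \<in> set zs" for z
  proof -
    obtain us vs where "zs = us @ z # vs"
      using z by (meson split_list)
    then show ?thesis
      using zs vwalkI_append_r[of "z # vs" us G] unfolding R_def
      by (intro exI[of _ "z # vs"]) auto
  qed
  have "R (hd p)" if "vwalk p G" "set p \<subseteq> D" "last p = last zs" "hd p \<notin> S" for p
    using that
  proof (induct p)
    case (Base u)
    then show ?case
      using zs \<open>zs \<noteq> []\<close> R_zs by simp
  next
    case (Cons u v es)
    show ?case
    proof (cases "v \<in> S")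
      \<comment> \<open>\<open>u\<close> lies outside \<open>S\<close> but is adjacent to
        \<open>v\<close> in \<open>S\<close>, hence belongs to \<open>zs\<close>.\<close>
      case True
      then show ?thesis
        using S(2) adj_sym Cons R_zs by fastforce
    next
      case False
      then obtain p where p: "vwalk p G" "set p \<subseteq> D - S" "hd p = v" "last p = last zs"
        using Cons unfolding R_def by auto
      then show ?thesis
        using Cons vwalk_wf_digraph_consI[of p u] unfolding R_def
        by (intro exI[of _ "u # p"]) (auto simp: vwalk_def)
    qed
  qed
  then have R: "R a" if "a \<in> D - S" for a
    using conn[of a "last zs"] that zs(2) \<open>zs \<noteq> []\<close>
    by (metis DiffD1 DiffD2 last_in_set subsetD vpathE)
  have "\<exists>p. vpath p G \<and> set p \<subseteq> D - S \<and> hd p = a \<and> last p = b" if ab: "a \<in> D - S" "b \<in> D - S" for a b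
  proof -
    obtain p where p: "vwalk p G" "set p \<subseteq> D - S" "hd p = a" "last p = last zs"
      using R ab unfolding R_def by blast
    obtain q where q: "vwalk q G" "set q \<subseteq> D - S" "hd q = b" "last q = last zs"
      using R ab unfolding R_def by blast
    have ne: "p \<noteq> []" "q \<noteq> []" using p q by auto
    then have "vwalk (p \<oplus> rev q) G"
      using p q vwalk_rev_ex[OF sym_arcs q(1)] by (auto intro!: vwalk_joinI_vwalk simp: hd_rev)
    then obtain r where "vpath r G" "set r \<subseteq> set (p \<oplus> rev q)"
        "hd r = hd (p \<oplus> rev q)" "last r = last (p \<oplus> rev q)"
      using vwalk_imp_short_vpath by metis
    moreover have "set (p \<oplus> rev q) \<subseteq> D - S"
      using p(2) q(2) set_vwalk_join_subset[of p "rev q"] by auto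
    moreover have "hd (p \<oplus> rev q) = a" "last (p \<oplus> rev q) = b"
      using p q ne by (auto simp: vwalk_join_hd vwalk_join_last last_rev hd_rev)
    ultimately show ?thesis by blast
  qed
  moreover have "D - S \<noteq> {}"
    using zs \<open>zs \<noteq> []\<close> by (metis Diff_iff disjoint_iff empty_iff last_in_set subsetD)
  moreover have "dominating_set G (D - S)"
    unfolding dominating_set_def
  proof (intro conjI ballI)
    fix v assume v: "v \<in> verts G - (D - S)"
    show "\<exists>u\<in>D - S. v \<rightarrow> u"
    proof (cases "v \<in> S")
      case True
      then show ?thesis
        using S(3) zs by blast
    next
      case False
      then obtain u where u: "u \<in> D" "v \<rightarrow> u" "v \<notin> D"
        using D v unfolding connected_dominating_set_def dominating_set_def by blast
      \<comment> \<open>A neighbour \<open>u\<close> in \<open>S\<close> would put \<open>v\<close>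
        into \<open>S\<close> or \<open>zs\<close>, hence into \<open>D\<close>.\<close>
      then have "u \<notin> S"
        using S(1,2) adj_sym zs(2) False by blast
      then show ?thesis
        using u by blast
    qed
  qed (use sub in blast)
  ultimately show ?thesis
    using connected_induce_subgraph_iff[of "D - S"] sub
    unfolding connected_dominating_set_def by blast
qed


section \<open>Cycle neighbours, and vertices added to or missing from a connected dominating
  set\<close>

lemma vwalk_Cons_iff:
  assumes "p \<noteq> []"
  shows "vwalk (u # p) G \<longleftrightarrow> u \<rightarrow> hd p \<and> vwalk p G"
  using assms by (cases p) auto

text \<open>Used to close a run of vertices missing from a set with a path inside that set, where
  disjointness is immediate.\<close>

lemma vcycle_append_iff:
  assumes "xs \<noteq> []" "ys \<noteq> []"
  shows "vcycle G (xs @ ys) \<longleftrightarrow> 3 \<le> length xs + length ys \<and> distinct (xs @ ys) \<and>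
    vwalk xs G \<and> vwalk ys G \<and> last xs \<rightarrow> hd ys \<and> last ys \<rightarrow> hd xs"
  using assms by (auto simp: vcycle_def vwalk_Cons_iff vwalk_append_iff)

lemma vcycle_neighbours:
  assumes "vcycle G (x # ys)"
  shows "{hd ys, last ys} \<subseteq> {w. x \<rightarrow> w}" "hd ys \<noteq> last ys"
proof -
  have *: "2 \<le> length ys" "distinct ys" "x \<rightarrow> hd ys" "last ys \<rightarrow> x"
    using assms by (auto simp: vcycle_Cons_iff)
  then show "{hd ys, last ys} \<subseteq> {w. x \<rightarrow> w}"
    using adj_sym by auto
  show "hd ys \<noteq> last ys"
    using * by (cases ys) auto
qed

text \<open>The two cycle neighbours are distinct, so a degree below 3 leaves room for no
  other.\<close>

lemma neighbours_of_degree_2: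
  assumes "vcycle G (x # ys)" "out_degree G x < 3"
  shows "{w. x \<rightarrow> w} = {hd ys, last ys}" "out_degree G x = 2"
proof -
  have "card {hd ys, last ys} = 2"
    using vcycle_neighbours[OF assms(1)] by simp
  then show "{w. x \<rightarrow> w} = {hd ys, last ys}"
    using card_seteq[OF finite_neighbours vcycle_neighbours(1)[OF assms(1)]] assms(2)
    by (simp add: out_degree_eq_card)
  then show "out_degree G x = 2"
    using \<open>card {hd ys, last ys} = 2\<close> by (simp add: out_degree_eq_card)
qed

lemma connected_dominating_setD:
  assumes "connected_dominating_set G D"
  shows "D \<subseteq> verts G" "D \<noteq> {}"
    "v \<in> verts G \<Longrightarrow> v \<notin> D \<Longrightarrow> \<exists>u\<in>D. v \<rightarrow> u"
    "a \<in> D \<Longrightarrow> b \<in> D \<Longrightarrow> \<exists>p. vpath p G \<and> set p \<subseteq> D \<and> hd p = a \<and> last p = b"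
  using assms connected_induce_subgraph_iff[of D]
  by (auto simp: connected_dominating_set_def dominating_set_def)

lemma connected_dominating_set_insert:
  assumes D: "connected_dominating_set G D" and x: "d \<in> D" "x \<rightarrow> d"
  shows "connected_dominating_set G (insert x D)"
proof (cases "x \<in> D")
  case False
  have sub: "insert x D \<subseteq> verts G"
    using connected_dominating_setD(1)[OF D] x by (auto dest: adj_in_verts)
  have to_x: "\<exists>p. vpath p G \<and> set p \<subseteq> insert x D \<and> hd p = x \<and> last p = b" if b: "b \<in> D" for b
  proof -
    obtain p where p: "vpath p G" "set p \<subseteq> D" "hd p = d" "last p = b"
      using connected_dominating_setD(4)[OF D x(1) b] by blast
    then have "p \<noteq> []" by auto
    then show ?thesis
      using p x False by (intro exI[of _ "x # p"]) (auto simp: vpath_def vwalk_Cons_iff)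
  qed
  have from_x: "\<exists>p. vpath p G \<and> set p \<subseteq> insert x D \<and> hd p = a \<and> last p = x" if "a \<in> D" for a
  proof -
    obtain p where "vpath p G" "set p \<subseteq> insert x D" "hd p = x" "last p = a"
      using to_x \<open>a \<in> D\<close> by blast
    then show ?thesis
      using vwalk_rev_ex[OF sym_arcs, of p]
      by (intro exI[of _ "rev p"]) (auto simp: vpath_def hd_rev last_rev)
  qed
  have "\<exists>p. vpath p G \<and> set p \<subseteq> insert x D \<and> hd p = x \<and> last p = x"
    using sub by (intro exI[of _ "[x]"]) (auto simp: vpath_def)
  then have "\<exists>p. vpath p G \<and> set p \<subseteq> insert x D \<and> hd p = a \<and> last p = b"
    if "a \<in> insert x D" "b \<in> insert x D" for a b
    using that to_x from_x connected_dominating_setD(4)[OF D, of a b] by blast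
  then have "Digraph_Component.connected (G \<restriction> insert x D)"
    using connected_induce_subgraph_iff[OF sub] by blast
  then show ?thesis
    using sub D unfolding connected_dominating_set_def dominating_set_def by blast
qed (use D in \<open>simp add: insert_absorb\<close>)

text \<open>Every vertex other than \<open>x\<close> is in \<open>D\<close> or one step away from
  it, and \<open>D\<close> is connected without \<open>x\<close>. Thus a missing vertex is never a
  cut vertex.\<close>

lemma dominating_connected_outside:
  assumes D: "connected_dominating_set G D" "x \<notin> D"
    and "u \<in> verts G" "u \<noteq> x" "v \<in> verts G" "v \<noteq> x"
  obtains p where "vpath p G" "x \<notin> set p" "hd p = u" "last p = v"
proof -
  have near: "\<exists>p d. vwalk p G \<and> x \<notin> set p \<and> hd p = w \<and> last p = d \<and> d \<in> D"
    if w: "w \<in> verts G" "w \<noteq> x" for w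
  proof (cases "w \<in> D")
    case True
    then show ?thesis
      using w by (intro exI[of _ "[w]"]) auto
  next
    case False
    then obtain d where "d \<in> D" "w \<rightarrow> d"
      using connected_dominating_setD(3)[OF D(1)] w by blast
    then show ?thesis
      using w D(2) by (intro exI[of _ "[w, d]"]) (auto dest: adj_in_verts)
  qed
  obtain p d where p: "vwalk p G" "x \<notin> set p" "hd p = u" "last p = d" "d \<in> D"
    using near assms by blast
  obtain q e where q: "vwalk q G" "x \<notin> set q" "hd q = v" "last q = e" "e \<in> D"
    using near assms by blast
  obtain r where r: "vpath r G" "set r \<subseteq> D" "hd r = d" "last r = e"
    using connected_dominating_setD(4)[OF D(1)] p q by blast
  have ne: "p \<noteq> []" "q \<noteq> []" "r \<noteq> []"
    using p q r by auto
  define w where "w = p \<oplus> (r \<oplus> rev q)"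
  have "vwalk (r \<oplus> rev q) G"
    using r q ne vwalk_rev_ex[OF sym_arcs q(1)] by (auto intro!: vwalk_joinI_vwalk simp: hd_rev)
  then have "vwalk w G"
    unfolding w_def using p r q ne
    by (intro vwalk_joinI_vwalk[of p]) (auto simp: vwalk_join_hd hd_rev vpath_def)
  then obtain s where "vpath s G" "hd s = hd w" "last s = last w" "set s \<subseteq> set w"
    using vwalk_imp_short_vpath by metis
  moreover have "hd w = u" "last w = v"
    unfolding w_def using p q r ne by (auto simp: vwalk_join_hd vwalk_join_last last_rev hd_rev)
  moreover have "x \<notin> set w"
    unfolding w_def using p(2) q(2) r(2) D(2)
      set_vwalk_join_subset[of p "r \<oplus> rev q"] set_vwalk_join_subset[of r "rev q"] by auto
  ultimately show thesis
    using that by blast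
qed

end

section \<open>Cycles of a cactus and the vertices missing from a connected dominating set\<close>

locale cactus_graph = graph +
  assumes cactus: "cactus G"
begin

lemma connected: "Digraph_Component.connected G"
  using cactus by (simp add: cactus_def)

text \<open>The cactus condition in contrapositive form, carried over to vertex lists.\<close>

lemma vcycle_edges_eq:
  assumes xs: "vcycle G xs" and ys: "vcycle G ys"
    and uv: "u \<noteq> v" "{u, v} \<subseteq> set xs" "{u, v} \<subseteq> set ys"
  shows "vcycle_edges xs = vcycle_edges ys"
proof (rule ccontr)
  assume ne: "vcycle_edges xs \<noteq> vcycle_edges ys"
  obtain c where c: "simple_cycle G c" "cycle_verts G c = set xs" "cycle_edges G c = vcycle_edges xs"
    using vcycle_imp_simple_cycle[OF xs] by metis
  obtain d where d: "simple_cycle G d" "cycle_verts G d = set ys" "cycle_edges G d = vcycle_edges ys"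
    using vcycle_imp_simple_cycle[OF ys] by metis
  have "card (set xs \<inter> set ys) \<le> 1"
    using cactus c d ne unfolding cactus_def by metis
  moreover have "card {u, v} \<le> card (set xs \<inter> set ys)"
    using uv by (intro card_mono) auto
  ultimately show False
    using uv by simp
qed

text \<open>For necessity: a geodesic closed to a short cycle through two vertices of a given cycle
  bounds the length of the latter.\<close>

lemma vcycle_length_eq:
  assumes "vcycle G xs" "vcycle G ys" "u \<noteq> v" "{u, v} \<subseteq> set xs" "{u, v} \<subseteq> set ys"
  shows "length xs = length ys"
proof -
  have "set xs = set ys"
    using vcycle_edges_eq[OF assms] assms(4,5) Union_vcycle_edges[of xs] Union_vcycle_edges[of ys]
    by (cases "xs = []"; cases "ys = []") auto
  then show ?thesis
    using assms(1,2) distinct_card[of xs] distinct_card[of ys] by (simp add: vcycle_def)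
qed

lemma degree_of_missing:
  assumes c: "vcycle G (x # ys)" and D: "connected_dominating_set G D" "x \<notin> D"
  shows "{w. x \<rightarrow> w} = {hd ys, last ys}" "out_degree G x = 2"
proof -
  have ys: "ys \<noteq> []" "x \<notin> set ys" "x \<rightarrow> hd ys"
    using c by (auto simp: vcycle_Cons_iff)
  have "w = hd ys \<or> w = last ys" if w: "x \<rightarrow> w" for w
  proof (cases "w = hd ys")
    case False
    obtain p where p: "vpath p G" "x \<notin> set p" "hd p = hd ys" "last p = w"
      using dominating_connected_outside[OF D, of "hd ys" w] w ys adj_irrefl
      by (metis adj_in_verts(2) hd_in_set)
    have "p \<noteq> []" using p by auto
    then have "2 \<le> length p"
      using p False by (cases p rule: remdups_adj.cases) auto
    then have cp: "vcycle G (x # p)"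
      using p ys w adj_sym by (auto simp: vcycle_Cons_iff vpath_def)
    \<comment> \<open>Both cycles contain \<open>x\<close> and \<open>hd ys\<close>, so their edges
      agree. Hence the edge from \<open>x\<close> to \<open>w\<close> lies on the given cycle, and
      \<open>w\<close> is one of the two neighbours of \<open>x\<close> there.\<close>
    have "vcycle_edges (x # p) = vcycle_edges (x # ys)"
      using vcycle_edges_eq[OF cp c, of x "hd ys"] p \<open>p \<noteq> []\<close> ys by (metis
          hd_in_set insert_subset list.set_intros empty_subsetI)
    moreover have "{x, w} \<in> vcycle_edges (x # p)"
      using p \<open>p \<noteq> []\<close> by (auto simp: vcycle_edges_def)
    ultimately show ?thesis
      using vcycle_edges_Cons ys by metis
  qed simp
  then show "{w. x \<rightarrow> w} = {hd ys, last ys}"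
    using vcycle_neighbours[OF c] by auto
  then show "out_degree G x = 2"
    using vcycle_neighbours[OF c] by (simp add: out_degree_eq_card)
qed

text \<open>The vertex that dominates \<open>x\<close> is a neighbour of \<open>x\<close>, and these
  all lie on the cycle. This is what limits runs of missing vertices.\<close>

lemma missing_has_cycle_neighbour:
  assumes c: "vcycle G (x # ys)" and D: "connected_dominating_set G D" "x \<notin> D"
  shows "hd ys \<in> D \<or> last ys \<in> D"
proof -
  have "x \<in> verts G"
    using c by (auto simp: vcycle_Cons_iff dest: adj_in_verts)
  then obtain u where "u \<in> D" "x \<rightarrow> u"
    using connected_dominating_setD(3)[OF D(1)] D(2) by blast
  then have "u \<in> {hd ys, last ys}"
    using degree_of_missing(1)[OF c D] by blast
  then show ?thesis
    using \<open>u \<in> D\<close> by auto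
qed

section \<open>Necessity of the cycle conditions\<close>

lemma minimum_weakly_convex_imp_cycle_condition:
  assumes D: "dominating_set G D" "weakly_convex G D"
    and min: "\<And>D'. connected_dominating_set G D' \<Longrightarrow> card D \<le> card D'"
    and c: "vcycle G c" "5 \<le> length c" and v: "v \<in> set c" "out_degree G v < 3"
  shows "length c \<le> 6 \<and>
    (\<exists>u\<in>set c. \<exists>w\<in>set c. u \<rightarrow> w \<and> out_degree G u = 2 \<and> out_degree G w = 2)"
proof -
  have cds: "connected_dominating_set G D"
    using weakly_convex_dominating_imp_connected_dominating connected D by blast
  note sub = connected_dominating_setD(1)[OF cds]
  have fin: "finite D" using finite_subset[OF sub] by simp
  have geodesic: "\<exists>q. vpath q G \<and> set q \<subseteq> D \<and> hd q = hd p \<and> last q = last p \<and> length q \<le> length p"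
    if "vpath p G" "hd p \<in> D" "last p \<in> D" for p
    using D(2) that unfolding weakly_convex_iff[OF connected] by blast
  have "\<not> set c \<subseteq> D"
  proof
    assume "set c \<subseteq> D"
    obtain zs where zs: "vcycle G (v # zs)" "set (v # zs) = set c"
      using vcycle_starting_at c(1) v(1) by metis
    have nv: "{w. v \<rightarrow> w} = {hd zs, last zs}"
      using neighbours_of_degree_2[OF zs(1) v(2)] by blast
    have v': "vwalk zs G" "v \<notin> set zs" "zs \<noteq> []"
      using zs(1) by (auto simp: vcycle_Cons_iff)
    have "connected_dominating_set G (D - {v})"
    proof (rule connected_dominating_set_Diff[OF cds v'(1)])
      show "\<exists>z\<in>set zs. s \<rightarrow> z" if "s \<in> {v}" for s
        using nv that hd_in_set[OF v'(3)] by auto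
      show "w \<in> {v} \<union> set zs" if "s \<in> {v}" "s \<rightarrow> w" for s w
      proof -
        have "w \<in> {w. v \<rightarrow> w}" using that by simp
        then show ?thesis
          unfolding nv using hd_in_set[OF v'(3)] last_in_set[OF v'(3)] by auto
      qed
    qed (use zs(2) \<open>set c \<subseteq> D\<close> v' in auto)
    from min[OF this] show False
      using card_Diff1_less[OF fin, of v] v(1) \<open>set c \<subseteq> D\<close> by auto
  qed
  then obtain x where x: "x \<in> set c" "x \<notin> D" by blast
  \<comment> \<open>Orienting the cycle so that the vertex before \<open>x\<close> is in
    \<open>D\<close> makes \<open>x\<close> the first of its run of missing vertices.\<close>
  obtain ys where ys: "vcycle G (x # ys)" "set (x # ys) = set c" "length (x # ys) = length c"
      "last ys \<in> D"
  proof -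
    obtain zs where zs: "vcycle G (x # zs)" "set (x # zs) = set c" "length (x # zs) = length c"
      using vcycle_starting_at c(1) x(1) by metis
    have rev: "vcycle G (x # rev zs)"
      using vcycle_rotate[of G "rev zs" "[x]"] vcycle_rev[OF zs(1)] by simp
    have "last zs \<in> D \<or> last (rev zs) \<in> D"
      using missing_has_cycle_neighbour[OF zs(1) cds x(2)] by (auto simp: last_rev)
    then show thesis
      using that[of zs] that[of "rev zs"] zs rev by auto
  qed
  \<comment> \<open>\<open>ys\<close> has at least four entries, so \<open>last ys\<close> differs
    from \<open>y\<close> and \<open>y'\<close>.\<close>
  obtain y y' zs where yz: "ys = y # y' # zs" "zs \<noteq> []"
    using ys(3) c(2) by (cases ys; cases "tl ys"; cases "tl (tl ys)") auto
  have dist: "distinct (x # ys)" "vwalk ys G"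
    using ys(1) by (auto simp: vcycle_Cons_iff)
  have adj: "x \<rightarrow> y" "last ys \<rightarrow> x" "y \<rightarrow> y'"
    using ys(1) yz by (auto simp: vcycle_Cons_iff vwalk_Cons_iff)
  note verts = adj_in_verts[OF adj(1)] adj_in_verts[OF adj(2)] adj_in_verts[OF adj(3)]
  have last: "last ys \<in> set zs" "last ys = last zs"
    using yz by auto
  \<comment> \<open>If only \<open>x\<close> were missing, a path in \<open>D\<close> from
    \<open>y\<close> to \<open>last ys\<close> on at most three vertices would close with
    \<open>x\<close> to a cycle of length at most 4, which must be as long as
    \<open>c\<close>.\<close>
  have "y \<notin> D"
  proof
    assume "y \<in> D"
    have "vpath [y, x, last ys] G"
      using adj adj_sym dist last yz verts by (auto simp: vpath_def)
    then obtain q where q: "vpath q G" "set q \<subseteq> D" "hd q = y" "last q = last ys" "length q \<le> 3"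
      using geodesic[of "[y, x, last ys]"] ys(4) \<open>y \<in> D\<close> by auto
    then have ne: "q \<noteq> []" by auto
    have "2 \<le> length q"
      using q ne dist last yz by (cases q rule: remdups_adj.cases) auto
    then have "vcycle G (x # q)"
      using q adj x(2) by (auto simp: vcycle_Cons_iff vpath_def)
    moreover have "{x, y} \<subseteq> set (x # q)"
      using q ne hd_in_set by fastforce
    ultimately have "length (x # ys) = length (x # q)"
      using vcycle_length_eq[OF ys(1), of "x # q" x y] dist yz by auto
    then show False
      using ys(3) c(2) q(5) by simp
  qed
  have c': "vcycle G (y # y' # zs @ [x])"
    using vcycle_rotate[of G "[x]" ys] ys(1) yz by simp
  have "y' \<in> D"
    using missing_has_cycle_neighbour[OF c' cds \<open>y \<notin> D\<close>] x(2) by simp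
  \<comment> \<open>With \<open>x\<close> and \<open>y\<close> missing, the path through them has
    four vertices. Its replacement inside \<open>D\<close> closes with \<open>x\<close> and
    \<open>y\<close> to a cycle of length at most 6, and both of them have degree 2.\<close>
  have "vpath [y', y, x, last ys] G"
    using adj adj_sym dist last yz verts by (auto simp: vpath_def)
  then obtain q where q: "vpath q G" "set q \<subseteq> D" "hd q = y'" "last q = last ys" "length q \<le> 4"
    using geodesic[of "[y', y, x, last ys]"] ys(4) \<open>y' \<in> D\<close> by auto
  then have ne: "q \<noteq> []" by auto
  have "vcycle G ([x, y] @ q)"
    using q ne adj x(2) \<open>y \<notin> D\<close> dist yz verts Suc_le_eq
    by (subst vcycle_append_iff) (auto simp: vpath_def)
  then have "length (x # ys) = length ([x, y] @ q)"
    using vcycle_length_eq[OF ys(1), of "[x, y] @ q" x y] dist yz by auto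
  moreover have "out_degree G x = 2" "out_degree G y = 2"
    using degree_of_missing(2) ys(1) c' cds x(2) \<open>y \<notin> D\<close> by blast+
  moreover have "y \<in> set c"
    using ys(2) yz by auto
  ultimately show ?thesis
    using adj(1) x(1) ys(3) q(5) by auto
qed

section \<open>Sufficiency of the cycle conditions\<close>

lemma ear_missing_at_most_2:
  assumes D: "connected_dominating_set G D" and c: "vcycle G (xs @ p)"
    and xs: "set xs \<inter> D = {}"
  shows "length xs \<le> 2"
proof (rule ccontr)
  \<comment> \<open>The middle vertex of three consecutive missing ones is not dominated.\<close>
  assume "\<not> ?thesis"
  then obtain x y z zs where xyz: "xs = x # y # z # zs"
    by (cases xs; cases "tl xs"; cases "tl (tl xs)") auto
  have "vcycle G (y # z # zs @ p @ [x])"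
    using vcycle_rotate[of G "[x]" "y # z # zs @ p"] c xyz by simp
  then show False
    using missing_has_cycle_neighbour[OF _ D] xs xyz by fastforce
qed

text \<open>Once \<open>v\<close> is made to follow \<open>u\<close>, the rest \<open>zs\<close> of
  the cycle is a walk in \<open>D\<close> containing the other neighbour of each, as
  \<open>connected_dominating_set_Diff\<close> requires.\<close>

lemma remove_two_adjacent:
  assumes D: "connected_dominating_set G D" "set c \<subseteq> D"
    and c: "vcycle G c" "4 \<le> length c"
    and uv: "u \<in> set c" "u \<rightarrow> v" "out_degree G u = 2" "out_degree G v = 2"
  shows "connected_dominating_set G (D - {u, v})"
proof -
  obtain ys where ys: "vcycle G (u # ys)" "set (u # ys) = set c" "length (u # ys) = length c"
    using vcycle_starting_at c(1) uv(1) by metis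
  have "v \<in> {w. u \<rightarrow> w}" using uv by simp
  then have v: "v = hd ys \<or> v = last ys"
    using neighbours_of_degree_2(1)[OF ys(1)] uv by auto
  have "ys \<noteq> []" using ys(3) c(2) by auto
  obtain zs where zs: "vcycle G (u # v # zs)" "set (u # v # zs) = set c"
    "length (u # v # zs) = length c"
  proof (cases "v = hd ys")
    case True
    then show thesis
      using that[of "tl ys"] ys \<open>ys \<noteq> []\<close> by simp
  next
    case False
    \<comment> \<open>Here \<open>v\<close> precedes \<open>u\<close>, so the cycle is read
      backwards.\<close>
    then obtain ws where ws: "ys = ws @ [v]"
      using v \<open>ys \<noteq> []\<close> by (metis append_butlast_last_id)
    then have "vcycle G (u # v # rev ws)"
      using vcycle_rotate[of G "v # rev ws" "[u]"] vcycle_rev[OF ys(1)] by simp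
    then show thesis
      using that[of "rev ws"] ys ws by auto
  qed
  have "zs \<noteq> []" using zs(3) c(2) by auto
  then have zs': "zs \<noteq> []" "vwalk zs G" "{u, v} \<inter> set zs = {}"
    using zs(1) by (auto simp: vcycle_Cons_iff vwalk_Cons_iff)
  have nu: "{w. u \<rightarrow> w} = {v, last zs}"
    using neighbours_of_degree_2(1)[OF zs(1)] uv zs' by simp
  have "vcycle G (v # zs @ [u])"
    using vcycle_rotate[of G "[u]" "v # zs"] zs(1) by simp
  from neighbours_of_degree_2(1)[OF this] have nv: "{w. v \<rightarrow> w} = {hd zs, u}"
    using uv(4) zs'(1) by simp
  have mem: "hd zs \<in> set zs" "last zs \<in> set zs"
    using zs'(1) by auto
  show ?thesis
  proof (rule connected_dominating_set_Diff[OF D(1) zs'(2)])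
    show "w \<in> {u, v} \<union> set zs" if "s \<in> {u, v}" "s \<rightarrow> w" for s w
    proof -
      have "w \<in> {w. u \<rightarrow> w} \<union> {w. v \<rightarrow> w}" using that by auto
      then show ?thesis unfolding nu nv using mem by auto
    qed
    show "\<exists>z\<in>set zs. s \<rightarrow> z" if "s \<in> {u, v}" for s
      using that mem nu nv by auto
  qed (use zs(2) D(2) zs'(3) in auto)
qed

text \<open>An excursion from \<open>D\<close> through \<open>xs\<close> and back has
  \<open>length xs + 2\<close> vertices; the bound says that rerouting it along \<open>p\<close>
  makes it no longer.\<close>

lemma minimum_ear_bound:
  assumes D: "connected_dominating_set G D"
    and min: "\<And>D'. connected_dominating_set G D' \<Longrightarrow> card D \<le> card D'"
    and short: "\<And>c. vcycle G c \<Longrightarrow> length c \<in> {5, 6} \<Longrightarrow> (\<forall>v\<in>set c. 3 \<le> out_degree G v) \<or>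
      (\<exists>u\<in>set c. \<exists>v\<in>set c. u \<rightarrow> v \<and> out_degree G u = 2 \<and> out_degree G v = 2)"
    and long: "\<And>c. vcycle G c \<Longrightarrow> 7 \<le> length c \<Longrightarrow> \<forall>v\<in>set c. 3 \<le> out_degree G v"
    and c: "vcycle G (xs @ p)" "xs \<noteq> []" "set xs \<inter> D = {}" "set p \<subseteq> D"
  shows "length p \<le> length xs + 2"
proof -
  obtain x xs' where xs: "xs = x # xs'"
    using c(2) by (cases xs) auto
  have "x \<notin> D" using c(3) xs by auto
  have c': "vcycle G (x # xs' @ p)" using c(1) xs by simp
  have deg: "\<not> 3 \<le> out_degree G x"
    using degree_of_missing(2)[OF c' D \<open>x \<notin> D\<close>] by simp
  \<comment> \<open>A missing vertex has degree 2, which \<open>long\<close> forbids on cycles of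
    length 7 or more.\<close>
  have le6: "length (xs @ p) \<le> 6"
  proof (rule ccontr)
    assume "\<not> ?thesis"
    then show False
      using long[OF c(1)] deg xs by auto
  qed
  have le2: "length xs \<le> 2"
    using ear_missing_at_most_2[OF D c(1,3)] .
  \<comment> \<open>If only \<open>x\<close> is missing, adding it puts the whole cycle into the
    set, and the two adjacent degree 2 vertices given by \<open>short\<close> can be deleted: one
    vertex fewer than \<open>D\<close> in all.\<close>
  have eq2: "length xs = 2" if len: "5 \<le> length (xs @ p)"
  proof (rule ccontr)
    assume "length xs \<noteq> 2"
    then have xs: "xs = [x]"
      using le2 xs by (cases xs') auto
    have "length (xs @ p) \<in> {5, 6}"
      using len le6 by auto
    then obtain u v where uv: "u \<in> set (xs @ p)" "v \<in> set (xs @ p)" "u \<rightarrow> v"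
        "out_degree G u = 2" "out_degree G v = 2"
      using short[OF c(1)] deg xs by auto
    have fin: "finite D" using finite_subset[OF connected_dominating_setD(1)[OF D]] by simp
    have p: "p \<noteq> []" "last p \<rightarrow> x"
      using c(1) len xs by (auto simp: vcycle_Cons_iff)
    have "last p \<in> D" "x \<rightarrow> last p"
      using c(4) p last_in_set adj_sym by auto
    then have "connected_dominating_set G (insert x D)"
      using connected_dominating_set_insert[OF D] by blast
    then have "connected_dominating_set G (insert x D - {u, v})"
      using remove_two_adjacent[OF _ _ c(1) _ uv(1,3-5)] len c(4) xs by auto
    then have "card D \<le> card (insert x D - {u, v})"
      by (rule min)
    also have "\<dots> = card (insert x D) - card {u, v}"
      using uv(1,2) c(4) xs fin by (intro card_Diff_subset) auto
    also have "\<dots> < card D"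
    proof -
      have "u \<noteq> v" using uv(3) adj_irrefl by auto
      then have "card {u, v} = 2" by simp
      \<comment> \<open>Subtraction on naturals truncates, so
        \<open>Suc (card D) - 2 < card D\<close> needs a nonempty \<open>D\<close>.\<close>
      moreover have "0 < card D"
        using fin connected_dominating_setD(2)[OF D] by (simp add: card_gt_0_iff)
      ultimately show ?thesis
        using fin \<open>x \<notin> D\<close> by (simp del: card_gt_0_iff)
    qed
    finally show False by simp
  qed
  \<comment> \<open>One missing vertex forces a cycle of length at most 4, so at most three vertices
    in \<open>p\<close>; two missing vertices leave at most four.\<close>
  have "0 < length xs"
    using c(2) by simp
  then show ?thesis
    using le6 le2 eq2 unfolding length_append by linarith
qed

text \<open>Induction along a path: each excursion from \<open>D\<close> is replaced by a path
  inside \<open>D\<close>, no longer by \<open>minimum_ear_bound\<close>. The pieces may overlap, so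
  the induction yields walks, which are shortened to paths only at the end.\<close>

lemma minimum_connected_dominating_imp_weakly_convex:
  assumes D: "connected_dominating_set G D"
    and min: "\<And>D'. connected_dominating_set G D' \<Longrightarrow> card D \<le> card D'"
    and short: "\<And>c. vcycle G c \<Longrightarrow> length c \<in> {5, 6} \<Longrightarrow> (\<forall>v\<in>set c. 3 \<le> out_degree G v) \<or>
      (\<exists>u\<in>set c. \<exists>v\<in>set c. u \<rightarrow> v \<and> out_degree G u = 2 \<and> out_degree G v = 2)"
    and long: "\<And>c. vcycle G c \<Longrightarrow> 7 \<le> length c \<Longrightarrow> \<forall>v\<in>set c. 3 \<le> out_degree G v"
  shows "weakly_convex G D"
proof -
  have walk: "\<exists>q. vwalk q G \<and> set q \<subseteq> D \<and> hd q = hd p \<and> last q = last p \<and> length q \<le> length p"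
    if "vpath p G" "hd p \<in> D" "last p \<in> D" for p
    using that
  proof (induct "length p" arbitrary: p rule: less_induct)
    case less
    note p_in = less(2-4)
    obtain a r where p: "p = a # r" using p_in(1) by (cases p) auto
    then have "a \<in> D" using p_in by simp
    show ?case
    proof (cases "r = []")
      case True
      then show ?thesis
        using p_in p by (intro exI[of _ p]) (auto simp: vpath_def)
    next
      case False
      then have "last r \<in> D" "last r \<in> set r"
        using p_in p by auto
      \<comment> \<open>\<open>b\<close> is the first return to \<open>D\<close> after
        \<open>a\<close>, and \<open>xs\<close> is the possibly empty excursion in between.\<close>
      then obtain xs b s where r: "r = xs @ b # s" "b \<in> D" "\<forall>x\<in>set xs. x \<notin> D"
        using split_list_first_prop[of r "\<lambda>x. x \<in> D"] by blast
      have "vwalk (a # xs @ b # s) G" and dist: "distinct (a # xs @ b # s)"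
        using p_in p r by (auto simp: vpath_def)
      then have w: "vwalk (xs @ b # s) G" "a \<rightarrow> hd (xs @ b # s)"
        by (simp_all add: vwalk_Cons_iff)
      then have "vwalk (b # s) G"
        using vwalkI_append_r by blast
      then have "vpath (b # s) G" "last (b # s) = last p" "length (b # s) < length p"
        using dist p r by (auto simp: vpath_def)
      then obtain q where q: "vwalk q G" "set q \<subseteq> D" "hd q = b" "last q = last p"
          "length q \<le> length (b # s)"
        using less(1)[of "b # s"] r(2) p_in(3) by auto
      then have "q \<noteq> []" by auto
      show ?thesis
      proof (cases "xs = []")
        case True
        then show ?thesis
          using q w(2) \<open>q \<noteq> []\<close> \<open>a \<in> D\<close> p r
          by (intro exI[of _ "a # q"]) (auto simp: vwalk_Cons_iff)
      next
        case False
        obtain t where t: "vpath t G" "set t \<subseteq> D" "hd t = b" "last t = a"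
          using connected_dominating_setD(4)[OF D r(2) \<open>a \<in> D\<close>] by blast
        have "t \<noteq> []" "a \<noteq> b" using t dist by auto
        then have "2 \<le> length t"
          using t by (cases t rule: remdups_adj.cases) auto
        have "vwalk xs G" "last xs \<rightarrow> b"
          using w(1) False by (auto simp: vwalk_append_iff)
        \<comment> \<open>\<open>xs\<close> avoids \<open>D\<close> and \<open>t\<close> stays
          inside it, so they are disjoint. \<open>t\<close> runs from \<open>b\<close> back to
          \<open>a\<close>, which is why it is reversed below.\<close>
        then have "vcycle G (xs @ t)"
          using t False \<open>t \<noteq> []\<close> \<open>2 \<le> length t\<close> w(2) dist r(3) Suc_le_eq[of 0 "length xs"]
          by (subst vcycle_append_iff) (auto simp: vpath_def)
        then have len: "length t \<le> length xs + 2"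
          using minimum_ear_bound[OF D min short long _ False _ t(2)] r(3) by blast
        have "vwalk (rev t) G"
          using t(1) vwalk_rev_ex[OF sym_arcs] by (auto simp: vpath_def)
        then have "vwalk (rev t \<oplus> q) G"
          using q t \<open>q \<noteq> []\<close> \<open>t \<noteq> []\<close> by (auto intro!: vwalk_joinI_vwalk simp: last_rev)
        moreover have "hd (rev t \<oplus> q) = hd p" "last (rev t \<oplus> q) = last p"
          using q t p \<open>q \<noteq> []\<close> \<open>t \<noteq> []\<close>
          by (auto simp: vwalk_join_hd vwalk_join_last last_rev hd_rev)
        moreover have "set (rev t \<oplus> q) \<subseteq> D"
          using set_vwalk_join_subset[of "rev t" q] q(2) t(2) by auto
        \<comment> \<open>The join counts \<open>b\<close> once, so its length is at most
          \<open>length xs + 2\<close> plus \<open>length (b # s)\<close> minus 1, which is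
          \<open>length p\<close>.\<close>
        moreover have "length (rev t \<oplus> q) \<le> length p"
          using len q(5) p r by (simp add: vwalk_join_def)
        ultimately show ?thesis by blast
      qed
    qed
  qed
  have "\<exists>q. vpath q G \<and> set q \<subseteq> D \<and> hd q = hd p \<and> last q = last p \<and> length q \<le> length p"
    if "vpath p G" "hd p \<in> D" "last p \<in> D" for p
  proof -
    obtain q where q: "vwalk q G" "set q \<subseteq> D" "hd q = hd p" "last q = last p" "length q \<le> length p"
      using walk[of p] \<open>vpath p G\<close> \<open>hd p \<in> D\<close> \<open>last p \<in> D\<close> by blast
    obtain t where "vpath t G" "hd t = hd q" "last t = last q" "set t \<subseteq> set q" "length t \<le> length q"
      using vwalk_imp_short_vpath[OF q(1)] .
    then show ?thesis
      using q by (intro exI[of _ t]) auto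
  qed
  then show ?thesis
    using connected_dominating_setD(1)[OF D] unfolding weakly_convex_iff[OF connected] by blast
qed

section \<open>The two minima and the equivalence\<close>

lemma connected_dominating_set_verts: "connected_dominating_set G (verts G)"
proof -
  have "set p \<subseteq> verts G" if "vpath p G" for p
    using that by auto
  then have "Digraph_Component.connected (G \<restriction> verts G)"
    using connected unfolding connected_iff connected_induce_subgraph_iff[OF subset_refl] by metis
  then show ?thesis
    by (simp add: connected_dominating_set_def dominating_set_def)
qed

lemma weakly_convex_verts: "weakly_convex G (verts G)"
  unfolding weakly_convex_iff[OF connected] by (auto simp: vpath_def)

text \<open>\<open>Min\<close> is meaningful only on finite nonempty sets. As \<open>verts G\<close>
  belongs to both families, finiteness is what remains for both numbers to be attained.\<close>

lemma finite_card_subsets: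
  assumes "\<And>D. P D \<Longrightarrow> D \<subseteq> verts G"
  shows "finite {card D | D. P D}"
  by (rule finite_subset[of _ "card ` Pow (verts G)"]) (use assms in auto)

lemma connected_domination_number_attained:
  obtains D where "connected_dominating_set G D" "card D = \<gamma>\<^sub>c G"
    "\<And>D'. connected_dominating_set G D' \<Longrightarrow> card D \<le> card D'"
proof -
  let ?S = "{card D | D. connected_dominating_set G D}"
  have fin: "finite ?S"
    by (intro finite_card_subsets connected_dominating_setD(1))
  have "?S \<noteq> {}"
    using connected_dominating_set_verts by blast
  from Min_in[OF fin this] obtain D where "connected_dominating_set G D" "Min ?S = card D"
    by auto
  moreover have "Min ?S \<le> card D'" if "connected_dominating_set G D'" for D'
    by (rule Min_le[OF fin]) (use that in blast)
  ultimately show thesis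
    using that[of D] by (simp add: connected_domination_number_def)
qed

lemma weakly_convex_domination_number_attained:
  obtains D where "dominating_set G D" "weakly_convex G D" "card D = \<gamma>\<^sub>w\<^sub>c\<^sub>o\<^sub>n G"
    "\<And>D'. dominating_set G D' \<Longrightarrow> weakly_convex G D' \<Longrightarrow> card D \<le> card D'"
proof -
  let ?S = "{card D | D. dominating_set G D \<and> weakly_convex G D}"
  have fin: "finite ?S"
    by (intro finite_card_subsets) (simp add: dominating_set_def)
  have "?S \<noteq> {}"
    using weakly_convex_verts connected_dominating_set_verts
    by (auto simp: connected_dominating_set_def)
  from Min_in[OF fin this] obtain D where "dominating_set G D" "weakly_convex G D" "Min ?S = card D"
    by auto
  moreover have "Min ?S \<le> card D'" if "dominating_set G D'" "weakly_convex G D'" for D'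
    by (rule Min_le[OF fin]) (use that in blast)
  ultimately show thesis
    using that[of D] by (simp add: weakly_convex_domination_number_def)
qed

lemma domination_numbers_eq_iff:
  "\<gamma>\<^sub>c G = \<gamma>\<^sub>w\<^sub>c\<^sub>o\<^sub>n G \<longleftrightarrow>
    (\<forall>c. vcycle G c \<and> length c \<in> {5, 6} \<longrightarrow> (\<forall>v\<in>set c. 3 \<le> out_degree G v) \<or>
      (\<exists>u\<in>set c. \<exists>v\<in>set c. u \<rightarrow> v \<and> out_degree G u = 2 \<and> out_degree G v = 2)) \<and>
    (\<forall>c. vcycle G c \<and> 7 \<le> length c \<longrightarrow> (\<forall>v\<in>set c. 3 \<le> out_degree G v))"
  (is "?eq \<longleftrightarrow> ?short \<and> ?long")
proof
  assume ?eq
  obtain D where D: "dominating_set G D" "weakly_convex G D" "card D = \<gamma>\<^sub>w\<^sub>c\<^sub>o\<^sub>n G"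
    using weakly_convex_domination_number_attained by blast
  \<comment> \<open>Equality of the two numbers makes \<open>D\<close> minimum among all connected
    dominating sets as well.\<close>
  have min: "card D \<le> card D'" if "connected_dominating_set G D'" for D'
    using connected_domination_number_attained that D(3) \<open>?eq\<close> by metis
  note cond = minimum_weakly_convex_imp_cycle_condition[OF D(1,2) min]
  show "?short \<and> ?long"
  proof (intro conjI allI impI)
    fix c assume c: "vcycle G c \<and> length c \<in> {5, 6}"
    show "(\<forall>v\<in>set c. 3 \<le> out_degree G v) \<or>
      (\<exists>u\<in>set c. \<exists>v\<in>set c. u \<rightarrow> v \<and> out_degree G u = 2 \<and> out_degree G v = 2)"
    proof (cases "\<forall>v\<in>set c. 3 \<le> out_degree G v")
      case False
      then obtain v where "v \<in> set c" "out_degree G v < 3"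
        by (auto simp: not_le)
      then show ?thesis
        using cond[of c v] c by auto
    qed simp
  next
    fix c assume c: "vcycle G c \<and> 7 \<le> length c"
    show "\<forall>v\<in>set c. 3 \<le> out_degree G v"
    proof (rule ballI, rule ccontr)
      fix v assume "v \<in> set c" "\<not> 3 \<le> out_degree G v"
      then show False
        using cond[of c v] c by auto
    qed
  qed
next
  assume cond: "?short \<and> ?long"
  obtain D where D: "connected_dominating_set G D" "card D = \<gamma>\<^sub>c G"
    "\<And>D'. connected_dominating_set G D' \<Longrightarrow> card D \<le> card D'"
    using connected_domination_number_attained by blast
  obtain W where W: "dominating_set G W" "weakly_convex G W" "card W = \<gamma>\<^sub>w\<^sub>c\<^sub>o\<^sub>n G"
    "\<And>D'. dominating_set G D' \<Longrightarrow> weakly_convex G D' \<Longrightarrow> card W \<le> card D'"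
    using weakly_convex_domination_number_attained by blast
  \<comment> \<open>Being weakly convex, \<open>D\<close> competes with \<open>W\<close>; the
    reverse inequality holds in any case.\<close>
  have "weakly_convex G D"
    by (rule minimum_connected_dominating_imp_weakly_convex[OF D(1,3)]) (use cond in auto)
  then have "card W \<le> card D"
    using W(4) D(1) by (auto simp: connected_dominating_set_def)
  moreover have "card D \<le> card W"
    using D(3) weakly_convex_dominating_imp_connected_dominating[OF connected W(1,2)] .
  ultimately show ?eq
    using D(2) W(3) by simp
qed

end

theorem theorem3p1:
  fixes G :: "('a, 'b) pre_digraph"
  assumes "cactus G"
  shows "\<gamma>\<^sub>c G = \<gamma>\<^sub>w\<^sub>c\<^sub>o\<^sub>n G \<longleftrightarrow>
    (\<forall>C. simple_cycle G C \<and> length C \<in> {5, 6} \<longrightarrow>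
       (\<forall>v \<in> cycle_verts G C. out_degree G v \<ge> 3) \<or>
       (\<exists>u \<in> cycle_verts G C. \<exists>v \<in> cycle_verts G C.
          u \<rightarrow>\<^bsub>G\<^esub> v \<and> out_degree G u = 2 \<and> out_degree G v = 2)) \<and>
    (\<forall>C. simple_cycle G C \<and> length C \<ge> 7 \<longrightarrow>
       (\<forall>v \<in> cycle_verts G C. out_degree G v \<ge> 3))"
proof -
  interpret graph G
    using assms by (simp add: cactus_def)
  interpret cactus_graph G
    by unfold_locales (rule assms)
  \<comment> \<open>Both conditions depend on a cycle only through its length and vertex set, which
    the translations in both directions preserve.\<close>
  have transfer: "(\<forall>C. simple_cycle G C \<longrightarrow> P (length C) (cycle_verts G C)) \<longleftrightarrow>
      (\<forall>c. vcycle G c \<longrightarrow> P (length c) (set c))" for P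
    by (metis simple_cycle_imp_vcycle vcycle_imp_simple_cycle)
  show ?thesis
    unfolding domination_numbers_eq_iff imp_conjL
    using transfer[of "\<lambda>n V. n \<in> {5, 6} \<longrightarrow> (\<forall>v\<in>V. 3 \<le> out_degree G v) \<or>
        (\<exists>u\<in>V. \<exists>v\<in>V. u \<rightarrow>\<^bsub>G\<^esub> v \<and> out_degree G u = 2 \<and> out_degree G v = 2)"]
      transfer[of "\<lambda>n V. 7 \<le> n \<longrightarrow> (\<forall>v\<in>V. 3 \<le> out_degree G v)"]
    by simp
qed

end
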